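(* Let $n\ge3$ and let $Z$ be an $(n-1)$-cycle. Then there is a constant $C_Z$, depending only on the cycle $Z$, such that for any complex simplicial polyhedron $(Z,P)$ in $\mathbb{C}^n$, $$|V_Z(P)|\le C_Z\left(\max_{\{u,v\}\in\operatorname{supp}(Z)}|\ell_{uv}(P)|\right)^{n/2}.$$
   Context: $\Delta^M$ is an abstract simplex of (large) finite dimension $M$; $C_k(\Delta^M)$ is the free Abelian group generated by oriented $k$-faces of $\Delta^M$ (reversing orientation changes sign), $\partial$ the simplicial boundary operator. An $(n-1)$-cycle is a chain $Z\in C_{n-1}(\Delta^M)$ with $\partial Z=0$; $\operatorname{supp}(Z)$ is the subcomplex consisting of all $(n-1)$-simplices entering $Z$ with non-zero coefficients and all their faces. A complex simplicial polyhedron $(Z,P)$ of combinatorial type $Z$ is a map $P\colon|\operatorname{supp}(Z)|\to\mathbb{C}^n$ whose restriction to every simplex is linear (affine); it is determined by the arbitrary images $P(v)=(x_{v,1}(P),\ldots,x_{v,n}(P))\in\mathbb{C}^n$ of the vertices $v$. The squares of the orthogonal (non-Hermitian) edge lengths are $$\ell_{uv}(P)=\sum_{i=1}^n\bigl(x_{u,i}(P)-x_{v,i}(P)\bigr)^2\in\mathbb{C},$$ and the oriented volume is $$V_Z(P)=\frac1{n!}\sum_{j=1}^q c_j\det\bigl(P(v_1^{(j)}),\ldots,P(v_n^{(j)})\bigr)\in\mathbb{C},\qquad Z=\sum_{j=1}^q c_j\{v_1^{(j)},\ldots,v_n^{(j)}\},\ c_j\in\mathbb{Z},$$ where the determinant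 is of the matrix with the given columns and $\{v_1,\ldots,v_n\}$ denotes the simplex oriented by the ordering of its vertices. The maximum is over the edges $\{u,v\}$ of $\operatorname{supp}(Z)$; if $Z=0$ it is understood to be $0$. *)

theory Defs
  imports
    Complex_Main
    "HOL-Library.Poly_Mapping"
    "HOL-Combinatorics.Permutations"
    "Jordan_Normal_Form.Determinant"
begin

section \<open>Simplicial chains of the abstract simplex on the vertices \<open>0, \<dots>, M\<close>\<close>

text \<open>
  Since reversing the orientation changes the sign, the group of oriented \<open>k\<close>-chains is free
  abelian on the \<open>k\<close>-faces once one orientation per face is chosen. We choose the one given by the
  increasing order of the vertices: the generators are the strictly increasing lists, and the
  chain of a face with any other ordering of its vertices is \<open>oriented_face\<close> below.
\<close>

definition simplex_faces :: "nat \<Rightarrow> nat \<Rightarrow> nat list set" where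
  "simplex_faces M k = {vs. sorted_wrt (<) vs \<and> length vs = k + 1 \<and> set vs \<subseteq> {..M}}"

definition chains :: "nat \<Rightarrow> nat \<Rightarrow> (nat list \<Rightarrow>\<^sub>0 int) set" where
  "chains M k = {Z. Poly_Mapping.keys Z \<subseteq> simplex_faces M k}"

definition simplex_boundary :: "nat list \<Rightarrow> (nat list \<Rightarrow>\<^sub>0 int)" where
  "simplex_boundary vs =
     (if length vs \<le> 1 then 0
      else \<Sum>i<length vs. frag_cmul ((-1) ^ i) (frag_of (take i vs @ drop (Suc i) vs)))"

definition boundary :: "(nat list \<Rightarrow>\<^sub>0 int) \<Rightarrow> (nat list \<Rightarrow>\<^sub>0 int)" where
  "boundary = frag_extend simplex_boundary"

definition cycles :: "nat \<Rightarrow> nat \<Rightarrow> (nat list \<Rightarrow>\<^sub>0 int) set" where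
  "cycles M k = {Z \<in> chains M k. boundary Z = 0}"

definition supp :: "(nat list \<Rightarrow>\<^sub>0 int) \<Rightarrow> nat set set" where
  "supp Z = {F. F \<noteq> {} \<and> (\<exists>vs \<in> Poly_Mapping.keys Z. F \<subseteq> set vs)}"


section \<open>Complex simplicial polyhedra\<close>

text \<open>
  A simplexwise affine map on the realisation of \<open>supp Z\<close> is given by the (arbitrary) images of
  the vertices of \<open>supp Z\<close>; values of \<open>P\<close> at other indices are irrelevant.
\<close>

definition polyhedron :: "nat \<Rightarrow> (nat list \<Rightarrow>\<^sub>0 int) \<Rightarrow> (nat \<Rightarrow> complex vec) \<Rightarrow> bool" where
  "polyhedron n Z P \<longleftrightarrow> (\<forall>v. {v} \<in> supp Z \<longrightarrow> P v \<in> carrier_vec n)"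

definition sq_edge_length :: "nat \<Rightarrow> (nat \<Rightarrow> complex vec) \<Rightarrow> nat \<Rightarrow> nat \<Rightarrow> complex" where
  "sq_edge_length n P u v = (\<Sum>i<n. (P u $ i - P v $ i)\<^sup>2)"

definition max_sq_edge_length ::
    "nat \<Rightarrow> (nat list \<Rightarrow>\<^sub>0 int) \<Rightarrow> (nat \<Rightarrow> complex vec) \<Rightarrow> real" where
  "max_sq_edge_length n Z P =
     (if Z = 0 then 0
      else Max {cmod (sq_edge_length n P u v) | u v. u \<noteq> v \<and> {u, v} \<in> supp Z})"

definition oriented_volume ::
    "nat \<Rightarrow> (nat list \<Rightarrow>\<^sub>0 int) \<Rightarrow> (nat \<Rightarrow> complex vec) \<Rightarrow> complex" where
  "oriented_volume n Z P =
     (\<Sum>vs \<in> Poly_Mapping.keys Z.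
        of_int (Poly_Mapping.lookup Z vs) * det (mat_of_cols n (map P vs))) / fact n"


section \<open>Independence of the chosen orientations\<close>

text \<open>
  The chain \<open>{v\<^sub>1, \<dots>, v\<^sub>m}\<close> for vertices listed in an arbitrary order: it equals the sign of the
  sorting permutation times the generator of its face.
\<close>

definition oriented_face :: "nat list \<Rightarrow> (nat list \<Rightarrow>\<^sub>0 int)" where
  "oriented_face vs =
     frag_cmul (sign (THE p. p permutes {..<length vs} \<and> permute_list p vs = sort vs))
               (frag_of (sort vs))"

lemma oriented_face_eq:
  assumes "distinct vs" "p permutes {..<length vs}" "permute_list p vs = sort vs"
  shows "oriented_face vs = frag_cmul (sign p) (frag_of (sort vs))"
proof -
  have "q = p" if q: "q permutes {..<length vs}" "permute_list q vs = sort vs" for q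
  proof
    fix i
    show "q i = p i"
    proof (cases "i < length vs")
      case True
      then have "vs ! q i = vs ! p i"
        using permute_list_nth[OF q(1) True] permute_list_nth[OF assms(2) True] q(2) assms(3)
        by simp
      moreover have "q i < length vs" "p i < length vs"
        using permutes_in_image[OF q(1)] permutes_in_image[OF assms(2)] True by auto
      ultimately show ?thesis
        using assms(1) nth_eq_iff_index_eq by blast
    next
      case False
      then show ?thesis
        using permutes_not_in[OF q(1)] permutes_not_in[OF assms(2)] by simp
    qed
  qed
  then have "(THE q. q permutes {..<length vs} \<and> permute_list q vs = sort vs) = p"
    using assms(2,3) by (intro the_equality conjI) blast+
  then show ?thesis
    by (simp add: oriented_face_def)
qed

lemma sorting_permutation:
  obtains p where "p permutes {..<length vs}" "permute_list p vs = sort vs"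
  using mset_eq_permutation[OF mset_sort] by blast

lemma oriented_face_increasing:
  assumes "sorted_wrt (<) vs"
  shows "oriented_face vs = frag_of vs"
proof -
  from assms have "distinct vs" "sort vs = vs"
    by (simp_all add: strict_sorted_iff sorted_sort_id)
  then show ?thesis
    using oriented_face_eq[of vs id] by simp
qed

lemma oriented_face_permute:
  assumes "distinct vs" "p permutes {..<length vs}"
  shows "oriented_face (permute_list p vs) = frag_cmul (sign p) (oriented_face vs)"
proof -
  obtain q where q: "q permutes {..<length vs}" "permute_list q vs = sort vs"
    by (rule sorting_permutation)
  have ip: "Hilbert_Choice.inv p permutes {..<length vs}"
    by (rule permutes_inv[OF assms(2)])
  have ss: "sort (permute_list p vs) = sort vs"
    by (rule properties_for_sort) (simp_all add: assms)
  have "permute_list (Hilbert_Choice.inv p \<circ> q) (permute_list p vs)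
      = permute_list q (permute_list (Hilbert_Choice.inv p) (permute_list p vs))"
    by (rule permute_list_compose) (simp add: q(1))
  also have "permute_list (Hilbert_Choice.inv p) (permute_list p vs) = permute_list (p \<circ> Hilbert_Choice.inv p) vs"
    by (rule permute_list_compose[symmetric]) (simp add: ip)
  also have "\<dots> = vs"
    using permutes_inv_o(1)[OF assms(2)] by simp
  finally have "permute_list (Hilbert_Choice.inv p \<circ> q) (permute_list p vs) = sort (permute_list p vs)"
    by (simp only: q(2) ss)
  then have "oriented_face (permute_list p vs)
      = frag_cmul (sign (Hilbert_Choice.inv p \<circ> q)) (frag_of (sort (permute_list p vs)))"
    by (intro oriented_face_eq) (use assms permutes_compose[OF q(1) ip] in auto)
  also have "sign (Hilbert_Choice.inv p \<circ> q) = sign p * sign q"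
    using permutes_imp_permutation[OF _ assms(2)] permutes_imp_permutation[OF _ q(1)]
    by (simp add: sign_compose permutation_inverse sign_inverse)
  finally show ?thesis
    using oriented_face_eq[OF assms(1) q] ss by (simp add: frag_cmul_cmul)
qed

lemma oriented_volume_extend:
  assumes "finite K" "Poly_Mapping.keys Z \<subseteq> K"
  shows "oriented_volume n Z P =
     (\<Sum>vs \<in> K. of_int (Poly_Mapping.lookup Z vs) * det (mat_of_cols n (map P vs))) / fact n"
  unfolding oriented_volume_def
  by (subst sum.mono_neutral_left[OF assms]) (auto simp: in_keys_iff)

lemma oriented_volume_add:
  "oriented_volume n (Z + W) P = oriented_volume n Z P + oriented_volume n W P"
proof -
  let ?K = "Poly_Mapping.keys Z \<union> Poly_Mapping.keys W"
  have "finite ?K" by simp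
  from oriented_volume_extend[OF this, of Z] oriented_volume_extend[OF this, of W]
    oriented_volume_extend[OF this, of "Z + W"]
  show ?thesis
    using Poly_Mapping.keys_add[of Z W]
    by (simp add: lookup_add sum.distrib distrib_right add_divide_distrib)
qed

lemma oriented_volume_cmul:
  "oriented_volume n (frag_cmul c Z) P = of_int c * oriented_volume n Z P"
  by (subst oriented_volume_extend[of "Poly_Mapping.keys Z"])
     (auto simp: oriented_volume_def keys_cmul sum_distrib_left mult.assoc)

lemma oriented_volume_oriented_face:
  assumes "distinct vs" "length vs = n"
  shows "oriented_volume n (oriented_face vs) P = det (mat_of_cols n (map P vs)) / fact n"
proof -
  obtain p where p: "p permutes {..<length vs}" "permute_list p vs = sort vs"
    by (rule sorting_permutation)
  let ?A = "mat_of_cols n (map P vs)"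
  have pn: "p permutes {0..<n}"
    using p(1) assms(2) by (simp add: atLeast0LessThan)
  have "mat_of_cols n (map P (sort vs))
      = transpose_mat (mat n n (\<lambda>(i, j). transpose_mat ?A $$ (p i, j)))"
  proof (rule eq_matI, goal_cases)
    case (1 i j)
    then have "p j < n" "sort vs ! j = vs ! p j"
      using permutes_in_image[OF pn] permute_list_nth[OF p(1), of j] p(2) assms(2) by auto
    with 1 show ?case
      using assms(2) by (simp add: mat_of_cols_def)
  qed (use assms in auto)
  moreover have "det (transpose_mat ?A) = det ?A"
    by (rule det_transpose[of _ n]) (use assms in \<open>auto simp: mat_of_cols_def\<close>)
  moreover have "det (mat n n (\<lambda>(i, j). transpose_mat ?A $$ (p i, j)))
      = of_int (sign p) * det (transpose_mat ?A)"
    by (rule det_permute_rows[OF _ pn]) (use assms in \<open>auto simp: mat_of_cols_def\<close>)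
  ultimately have D: "det (mat_of_cols n (map P (sort vs))) = of_int (sign p) * det ?A"
    by (simp add: det_transpose[of _ n])
  have s: "of_int (sign p) * (of_int (sign p) * x) = x" for x :: complex
    by (simp add: sign_def)
  show ?thesis
    unfolding oriented_face_eq[OF assms(1) p] oriented_volume_cmul
    using s[of "det ?A / fact n"] by (simp add: oriented_volume_def D)
qed

text \<open>
  The volume may be computed from any expression \<open>Z = \<Sum>\<^sub>j c\<^sub>j {v\<^sub>1\<^sup>j, \<dots>, v\<^sub>n\<^sup>j}\<close>, with the vertices of
  each simplex listed in any order.
\<close>

lemma oriented_volume_representation:
  fixes q :: nat
  assumes "\<And>j. j < q \<Longrightarrow> distinct (v j) \<and> length (v j) = n"
    and "Z = (\<Sum>j<q. frag_cmul (c j) (oriented_face (v j)))"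
  shows "oriented_volume n Z P
    = (1 / fact n) * (\<Sum>j<q. of_int (c j) * det (mat_of_cols n (map P (v j))))"
proof -
  have "oriented_volume n (\<Sum>j<q. frag_cmul (c j) (oriented_face (v j))) P
      = (\<Sum>j<q. oriented_volume n (frag_cmul (c j) (oriented_face (v j))) P)"
    by (induction q) (simp_all add: oriented_volume_add, simp add: oriented_volume_def)
  also have "\<dots> = (\<Sum>j<q. of_int (c j) * (det (mat_of_cols n (map P (v j))) / fact n))"
    by (rule sum.cong) (auto simp: oriented_volume_cmul oriented_volume_oriented_face assms(1))
  finally show ?thesis
    using assms(2) by (simp add: sum_distrib_left field_simps sum_divide_distrib)
qed

end

theory Submission
  imports Defs "HOL-Analysis.L2_Norm"
begin

text \<open>
  Let \<open>c\<close> be the largest modulus of a squared edge length. The volume of the boundary of an \<open>n\<close>-simplex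
  is, up to sign, the volume of the simplex, whose square is a multiple of the Gram determinant of its edge
  vectors and hence a form of degree \<open>n\<close> in its squared edge lengths. So it suffices to write \<open>Z\<close> as
  the boundary of a chain of \<open>n\<close>-simplices all of whose squared edge lengths are at most \<open>K c\<close>, with a
  constant \<open>K\<close> independent of the polyhedron. In other words, the cycle has to bound in the clique
  complex of the graph of short edges, if these are allowed to become longer by a constant factor.
  
  The conformal lift replaces the points by isotropic vectors in dimension \<open>n + 2\<close> whose bilinear products
  are the squared edge lengths (\<open>dot_conformal_lift\<close>). Thus the claim becomes one about finitely
  many vectors in a \<open>d\<close>-dimensional complex space: in the graph of pairs whose product is bounded, cycles of
  dimension at least \<open>d div 2\<close> bound, up to constant factors (\<open>exists_fillable\<close>). The
  heuristic reason is that long vectors with bounded products behave like vectors of an isotropic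
  subspace, whose dimension is at most \<open>d div 2\<close>. The proof removes the vertex \<open>v\<close> with the longest vector.
  In the link of \<open>v\<close> all vectors are nearly orthogonal to a long nearly isotropic vector, and being no
  longer than this vector they interact, up to a bounded error, only through their components orthogonal to
  the plane spanned by it and its conjugate (\<open>exists_reducing_plane\<close>). These components live in
  dimension \<open>d - 2\<close>, while the link of a cycle has one dimension less, so that induction fills the link;
  replacing the star of \<open>v\<close> by this filling removes \<open>v\<close> (\<open>fill_by_removing_vertex\<close>).
  
  With \<open>d = n + 2\<close> the dimension \<open>n - 1\<close> of the cycle is large enough precisely for \<open>n \<ge> 3\<close>.
\<close>

section \<open>Exterior algebra of increasing chains\<close>

text \<open>
  The increasing list of the vertices of a face is read as a monomial of an exterior algebra. The
  boundary (augmented: a vertex has the empty face as its boundary), the cone with apex \<open>v\<close> (wedge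
  multiplication by \<open>v\<close>) and the link at \<open>v\<close> (contraction by \<open>v\<close>) all obey the signed Leibniz rule
  for the first vertex of the list. Taking this rule as their recursive definition puts every sign
  into the single term \<open>- prepend x\<close>, so that no position in a list ever has to be computed.
\<close>

definition prepend :: "nat \<Rightarrow> (nat list \<Rightarrow>\<^sub>0 int) \<Rightarrow> (nat list \<Rightarrow>\<^sub>0 int)" where
  "prepend x = frag_extend (\<lambda>xs. frag_of (x # xs))"

fun face_sum :: "nat list \<Rightarrow> (nat list \<Rightarrow>\<^sub>0 int)" where
  "face_sum [] = 0"
| "face_sum (x # xs) = frag_of xs - prepend x (face_sum xs)"

fun wedge_face :: "nat \<Rightarrow> nat list \<Rightarrow> (nat list \<Rightarrow>\<^sub>0 int)" where
  "wedge_face v [] = frag_of [v]"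
| "wedge_face v (x # xs) =
     (if v < x then frag_of (v # x # xs)
      else if v = x then 0
      else - prepend x (wedge_face v xs))"

fun contract_face :: "nat \<Rightarrow> nat list \<Rightarrow> (nat list \<Rightarrow>\<^sub>0 int)" where
  "contract_face v [] = 0"
| "contract_face v (x # xs) = (if x = v then frag_of xs else - prepend x (contract_face v xs))"

definition aug_boundary :: "(nat list \<Rightarrow>\<^sub>0 int) \<Rightarrow> (nat list \<Rightarrow>\<^sub>0 int)" where
  "aug_boundary = frag_extend face_sum"

definition wedge :: "nat \<Rightarrow> (nat list \<Rightarrow>\<^sub>0 int) \<Rightarrow> (nat list \<Rightarrow>\<^sub>0 int)" where
  "wedge v = frag_extend (wedge_face v)"

definition contract :: "nat \<Rightarrow> (nat list \<Rightarrow>\<^sub>0 int) \<Rightarrow> (nat list \<Rightarrow>\<^sub>0 int)" where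
  "contract v = frag_extend (contract_face v)"

lemmas chain_operator_defs = prepend_def aug_boundary_def wedge_def contract_def

lemma chain_operators_linear [simp]:
  "prepend x 0 = 0" "prepend x (a + b) = prepend x a + prepend x b"
  "prepend x (a - b) = prepend x a - prepend x b" "prepend x (- a) = - prepend x a"
  "aug_boundary 0 = 0" "aug_boundary (a + b) = aug_boundary a + aug_boundary b"
  "aug_boundary (a - b) = aug_boundary a - aug_boundary b" "aug_boundary (- a) = - aug_boundary a"
  "wedge x 0 = 0" "wedge x (a + b) = wedge x a + wedge x b"
  "wedge x (a - b) = wedge x a - wedge x b" "wedge x (- a) = - wedge x a"
  "contract x 0 = 0" "contract x (a + b) = contract x a + contract x b"
  "contract x (a - b) = contract x a - contract x b" "contract x (- a) = - contract x a"
  by (simp_all add: chain_operator_defs frag_extend_add frag_extend_diff frag_extend_minus)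

lemma chain_operators_frag_of [simp]:
  "prepend x (frag_of xs) = frag_of (x # xs)"
  "aug_boundary (frag_of xs) = face_sum xs"
  "wedge v (frag_of xs) = wedge_face v xs"
  "contract v (frag_of xs) = contract_face v xs"
  by (simp_all add: chain_operator_defs)

lemma chain_identity:
  assumes "\<And>xs. xs \<in> Poly_Mapping.keys c \<Longrightarrow> F (frag_of xs) = G (frag_of xs)"
    and "F 0 = 0" "G 0 = 0"
    and "\<And>a b. F (a - b) = F a - F b" "\<And>a b. G (a - b) = G a - (G b :: nat list \<Rightarrow>\<^sub>0 int)"
  shows "F c = G c"
  by (rule frag_induction[of c "Poly_Mapping.keys c" "\<lambda>c. F c = G c"]) (use assms in auto)

lemma keys_prepend: "Poly_Mapping.keys (prepend x c) \<subseteq> (#) x ` Poly_Mapping.keys c"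
  using keys_frag_extend[of "\<lambda>xs. frag_of (x # xs)" c] by (auto simp: prepend_def)

lemma keys_face_sum:
  assumes "sorted_wrt (<) xs" "ys \<in> Poly_Mapping.keys (face_sum xs)"
  shows "sorted_wrt (<) ys \<and> set ys \<subseteq> set xs \<and> length xs = Suc (length ys)"
  using assms
proof (induction xs arbitrary: ys)
  case (Cons x xs)
  from Cons.prems(2) have "ys = xs \<or> ys \<in> (#) x ` Poly_Mapping.keys (face_sum xs)"
    using keys_diff[of "frag_of xs" "prepend x (face_sum xs)"] keys_prepend by fastforce
  then show ?case
    using Cons.IH Cons.prems(1) by fastforce
qed simp

lemma aug_boundary_prepend: "aug_boundary (prepend x c) = c - prepend x (aug_boundary c)"
  by (rule chain_identity) auto

lemma contract_prepend:
  "contract v (prepend x c) = (if x = v then c else - prepend x (contract v c))"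
  by (cases "x = v") (simp_all, (rule chain_identity; simp)+)

lemma wedge_prepend_less: "x < v \<Longrightarrow> wedge v (prepend x c) = - prepend x (wedge v c)"
  by (rule chain_identity) auto

lemma wedge_prepend_same: "wedge v (prepend v c) = 0"
  by (rule chain_identity[where G = "\<lambda>_. 0"]) auto

lemma wedge_face_less: "sorted_wrt (<) (v # xs) \<Longrightarrow> wedge_face v xs = frag_of (v # xs)"
  by (cases xs) auto

lemma wedge_less:
  assumes "\<And>xs. xs \<in> Poly_Mapping.keys c \<Longrightarrow> sorted_wrt (<) (v # xs)"
  shows "wedge v c = prepend v c"
  by (rule chain_identity) (use assms wedge_face_less in auto)

text \<open>
  The cone with apex \<open>v\<close> is a contracting homotopy of the augmented chain complex, also on the faces
  that contain \<open>v\<close> already: there the first term vanishes and the second one restores the face.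
\<close>

lemma face_sum_wedge_face:
  "sorted_wrt (<) xs \<Longrightarrow> aug_boundary (wedge_face v xs) + wedge v (face_sum xs) = frag_of xs"
proof (induction xs)
  case Nil
  then show ?case by simp
next
  case (Cons x xs)
  have IH: "aug_boundary (wedge_face v xs) = frag_of xs - wedge v (face_sum xs)"
    using Cons by (simp add: algebra_simps)
  consider "v < x" | "v = x" | "x < v" by linarith
  then show ?case
  proof cases
    case 1
    have "wedge v (face_sum (x # xs)) = prepend v (face_sum (x # xs))"
      using keys_face_sum[OF Cons.prems] 1 Cons.prems
      by (intro wedge_less) fastforce
    then show ?thesis using 1 by (simp add: algebra_simps)
  next
    case 2
    then show ?thesis using wedge_face_less[of v xs] Cons.prems
      by (simp add: wedge_prepend_same)
  next
    case 3
    then show ?thesis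
      by (simp add: wedge_prepend_less aug_boundary_prepend IH)
  qed
qed

lemma contract_face_notin: "v \<notin> set xs \<Longrightarrow> contract_face v xs = 0"
  by (induction xs) auto

lemma face_sum_contract_face:
  "sorted_wrt (<) xs \<Longrightarrow> aug_boundary (contract_face v xs) = - contract v (face_sum xs)"
proof (induction xs)
  case (Cons x xs)
  then show ?case
    using contract_face_notin[of x xs]
    by (auto simp: contract_prepend aug_boundary_prepend)
qed simp

text \<open>
  Splitting of a face according to whether it contains \<open>v\<close>: the first term is the part without \<open>v\<close>,
  the second one the part with \<open>v\<close>.
\<close>

lemma contract_wedge_face:
  "sorted_wrt (<) xs \<Longrightarrow> contract v (wedge_face v xs) + wedge v (contract_face v xs) = frag_of xs"
proof (induction xs)
  case (Cons x xs)
  consider "v < x" | "v = x" | "x < v" by linarith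
  then show ?case
  proof cases
    case 1
    then show ?thesis using Cons.prems contract_face_notin[of v xs] by force
  next
    case 2
    then show ?thesis using wedge_face_less[of v xs] Cons.prems by simp
  next
    case 3
    have "contract v (wedge_face v xs) = frag_of xs - wedge v (contract_face v xs)"
      using Cons by (simp add: algebra_simps)
    with 3 show ?thesis by (simp add: contract_prepend wedge_prepend_less)
  qed
qed simp

definition increasing :: "(nat list \<Rightarrow>\<^sub>0 int) \<Rightarrow> bool" where
  "increasing c \<longleftrightarrow> (\<forall>xs \<in> Poly_Mapping.keys c. sorted_wrt (<) xs)"

lemma aug_boundary_wedge:
  assumes "increasing c"
  shows "aug_boundary (wedge v c) = c - wedge v (aug_boundary c)"
  by (rule chain_identity)
     (use assms face_sum_wedge_face[of _ v] in \<open>auto simp: increasing_def eq_diff_eq\<close>)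

lemma aug_boundary_contract:
  assumes "increasing c"
  shows "aug_boundary (contract v c) = - contract v (aug_boundary c)"
  by (rule chain_identity)
     (use assms face_sum_contract_face[of _ v] in \<open>auto simp: increasing_def\<close>)

lemma contract_wedge:
  assumes "increasing c"
  shows "contract v (wedge v c) = c - wedge v (contract v c)"
  by (rule chain_identity)
     (use assms contract_wedge_face[of _ v] in \<open>auto simp: increasing_def eq_diff_eq\<close>)

lemma face_sum_eq_sum:
  "face_sum xs = (\<Sum>i<length xs. frag_cmul ((-1) ^ i) (frag_of (take i xs @ drop (Suc i) xs)))"
proof (induction xs)
  case (Cons x xs)
  have "prepend x (\<Sum>i<k. frag_cmul ((-1) ^ i) (frag_of (take i xs @ drop (Suc i) xs)))
      = (\<Sum>i<k. frag_cmul ((-1) ^ i) (frag_of (x # take i xs @ drop (Suc i) xs)))" for k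
    by (induction k) (simp_all add: prepend_def frag_extend_add frag_extend_cmul)
  then show ?case
    by (simp add: Cons.IH sum.lessThan_Suc_shift  flip: sum_negf del: sum.lessThan_Suc)
qed simp

text \<open>
  The two boundaries differ on vertices only, where the augmented one is the empty face.
\<close>

lemma boundary_eq_aug_boundary:
  assumes "\<And>xs. xs \<in> Poly_Mapping.keys c \<Longrightarrow> length xs \<noteq> 1"
  shows "boundary c = aug_boundary c"
  unfolding boundary_def aug_boundary_def
proof (rule frag_extend_eq)
  fix xs assume "xs \<in> Poly_Mapping.keys c"
  then have "length xs \<noteq> 1" by (rule assms)
  then show "simplex_boundary xs = face_sum xs"
    by (cases "xs = []") (auto simp: simplex_boundary_def face_sum_eq_sum le_Suc_eq)
qed

lemma keys_wedge_face:
  assumes "sorted_wrt (<) xs" "ys \<in> Poly_Mapping.keys (wedge_face v xs)"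
  shows "sorted_wrt (<) ys \<and> set ys = insert v (set xs) \<and> v \<notin> set xs \<and> length ys = Suc (length xs)"
  using assms
proof (induction xs arbitrary: ys)
  case (Cons x xs)
  consider "v < x" | "v = x" | "x < v" by linarith
  then show ?case
  proof cases
    case 3
    then obtain zs where "ys = x # zs" "zs \<in> Poly_Mapping.keys (wedge_face v xs)"
      using Cons.prems(2) keys_prepend by fastforce
    then show ?thesis
      using Cons.IH[of zs] Cons.prems(1) 3 by auto
  qed (use Cons.prems in auto)
qed simp

lemma keys_contract_face:
  assumes "sorted_wrt (<) xs" "ys \<in> Poly_Mapping.keys (contract_face v xs)"
  shows "sorted_wrt (<) ys \<and> set xs = insert v (set ys) \<and> v \<notin> set ys \<and> length xs = Suc (length ys)"
  using assms
proof (induction xs arbitrary: ys)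
  case (Cons x xs)
  show ?case
  proof (cases "x = v")
    case False
    then obtain zs where "ys = x # zs" "zs \<in> Poly_Mapping.keys (contract_face v xs)"
      using Cons.prems(2) keys_prepend by fastforce
    then show ?thesis
      using Cons.IH[of zs] Cons.prems(1) False by auto
  qed (use Cons.prems in auto)
qed simp

section \<open>Chains on the cliques of a graph\<close>

text \<open>
  The \<open>(m - 1)\<close>-faces of the clique complex of the graph \<open>R\<close> on \<open>U\<close>. The condition includes the
  diagonal \<open>R u u\<close>, which restricts the vertices that occur.
\<close>

definition cliques :: "nat set \<Rightarrow> (nat \<Rightarrow> nat \<Rightarrow> bool) \<Rightarrow> nat \<Rightarrow> nat list set" where
  "cliques U R m =
     {xs. sorted_wrt (<) xs \<and> length xs = m \<and> set xs \<subseteq> U \<and> (\<forall>u\<in>set xs. \<forall>w\<in>set xs. R u w)}"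

lemma cliques_mono:
  assumes "U \<subseteq> U'" "\<And>u w. u \<in> U \<Longrightarrow> w \<in> U \<Longrightarrow> R u w \<Longrightarrow> R' u w"
  shows "cliques U R m \<subseteq> cliques U' R' m"
  using assms unfolding cliques_def by blast

lemma increasing_cliques: "Poly_Mapping.keys c \<subseteq> cliques U R m \<Longrightarrow> increasing c"
  by (auto simp: increasing_def cliques_def)

lemma keys_wedgeE:
  assumes "increasing c" "ys \<in> Poly_Mapping.keys (wedge v c)"
  obtains xs where "xs \<in> Poly_Mapping.keys c" "sorted_wrt (<) ys" "set ys = insert v (set xs)"
    "v \<notin> set xs" "length ys = Suc (length xs)"
proof -
  obtain xs where "xs \<in> Poly_Mapping.keys c" "ys \<in> Poly_Mapping.keys (wedge_face v xs)"
    using assms(2) keys_frag_extend[of "wedge_face v" c] by (auto simp: wedge_def)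
  then show thesis
    using that assms(1) keys_wedge_face[of xs ys v] by (auto simp: increasing_def)
qed

lemma keys_contractE:
  assumes "increasing c" "ys \<in> Poly_Mapping.keys (contract v c)"
  obtains xs where "xs \<in> Poly_Mapping.keys c" "sorted_wrt (<) ys" "set xs = insert v (set ys)"
    "v \<notin> set ys" "length xs = Suc (length ys)"
proof -
  obtain xs where "xs \<in> Poly_Mapping.keys c" "ys \<in> Poly_Mapping.keys (contract_face v xs)"
    using assms(2) keys_frag_extend[of "contract_face v" c] by (auto simp: contract_def)
  then show thesis
    using that assms(1) keys_contract_face[of xs ys v] by (auto simp: increasing_def)
qed

lemma wedge_cliques:
  assumes "Poly_Mapping.keys c \<subseteq> cliques U' R m" "insert v U' \<subseteq> U" "R v v"
    and "\<And>u. u \<in> U' \<Longrightarrow> R u v \<and> R v u"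
  shows "Poly_Mapping.keys (wedge v c) \<subseteq> cliques U R (Suc m)"
proof
  fix ys assume "ys \<in> Poly_Mapping.keys (wedge v c)"
  then obtain xs where xs: "xs \<in> Poly_Mapping.keys c" "sorted_wrt (<) ys" "set ys = insert v (set xs)"
      "length ys = Suc (length xs)"
    by (rule keys_wedgeE[OF increasing_cliques[OF assms(1)]])
  then have "xs \<in> cliques U' R m" using assms(1) by blast
  then show "ys \<in> cliques U R (Suc m)"
    using xs assms(2-4) by (auto simp: cliques_def)
qed

text \<open>
  The link of \<open>v\<close> in a clique complex is the clique complex on the neighbours of \<open>v\<close>.
\<close>

lemma contract_cliques:
  assumes "Poly_Mapping.keys c \<subseteq> cliques U R (Suc m)"
  shows "Poly_Mapping.keys (contract v c) \<subseteq> cliques {u \<in> U - {v}. R v u \<and> R u u} R m"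
proof
  fix ys assume "ys \<in> Poly_Mapping.keys (contract v c)"
  then obtain xs where xs: "xs \<in> Poly_Mapping.keys c" "sorted_wrt (<) ys" "set xs = insert v (set ys)"
      "v \<notin> set ys" "length xs = Suc (length ys)"
    by (rule keys_contractE[OF increasing_cliques[OF assms(1)]])
  then have "xs \<in> cliques U R (Suc m)" using assms(1) by blast
  then show "ys \<in> cliques {u \<in> U - {v}. R v u \<and> R u u} R m"
    using xs by (auto simp: cliques_def)
qed

lemma contract_wedge_cliques:
  assumes "Poly_Mapping.keys c \<subseteq> cliques U R m"
  shows "Poly_Mapping.keys (contract v (wedge v c)) \<subseteq> cliques (U - {v}) R m"
proof
  have inc: "increasing (wedge v c)"
    using keys_wedgeE[OF increasing_cliques[OF assms]] unfolding increasing_def by metis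
  fix ys assume "ys \<in> Poly_Mapping.keys (contract v (wedge v c))"
  then obtain zs where zs: "zs \<in> Poly_Mapping.keys (wedge v c)" "sorted_wrt (<) ys"
      "set zs = insert v (set ys)" "v \<notin> set ys" "length zs = Suc (length ys)"
    by (rule keys_contractE[OF inc])
  from zs(1) obtain xs where xs: "xs \<in> Poly_Mapping.keys c" "set zs = insert v (set xs)"
      "v \<notin> set xs" "length zs = Suc (length xs)"
    by (rule keys_wedgeE[OF increasing_cliques[OF assms]])
  have "xs \<in> cliques U R m" using xs assms by blast
  moreover have "set ys = set xs" using xs zs by (metis insert_ident)
  ultimately show "ys \<in> cliques (U - {v}) R m"
    using xs zs by (auto simp: cliques_def)
qed

text \<open>
  Removing the vertex \<open>v\<close> from a cycle \<open>Z\<close> whose link at \<open>v\<close> is filled by \<open>Y\<close>: the star of \<open>v\<close> in \<open>Z\<close>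
  is replaced by \<open>Y\<close>, at the price of the boundary of the cone over \<open>Y\<close>. The new cycle is the part of
  \<open>Z\<close> that avoids \<open>v\<close> plus \<open>Y\<close>.
\<close>

lemma fill_by_removing_vertex:
  assumes "increasing Z" "increasing Y" "aug_boundary Z = 0" "aug_boundary Y = contract v Z"
  shows "aug_boundary (contract v (wedge v Z) + Y) = 0"
    and "Z = contract v (wedge v Z) + Y - aug_boundary (wedge v Y)"
proof -
  have inc: "increasing (wedge v Z)"
    using keys_wedgeE[OF assms(1)] unfolding increasing_def by metis
  show "aug_boundary (contract v (wedge v Z) + Y) = 0"
    using aug_boundary_contract[OF inc] aug_boundary_wedge[OF assms(1)] assms(3,4) by simp
  show "Z = contract v (wedge v Z) + Y - aug_boundary (wedge v Y)"
    using aug_boundary_wedge[OF assms(2)] contract_wedge[OF assms(1)] assms(4) by simp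
qed

section \<open>Removing an almost isotropic direction\<close>

definition dot :: "nat \<Rightarrow> (nat \<Rightarrow> complex) \<Rightarrow> (nat \<Rightarrow> complex) \<Rightarrow> complex" where
  "dot n p q = (\<Sum>i<n. p i * q i)"

definition hnorm :: "nat \<Rightarrow> (nat \<Rightarrow> complex) \<Rightarrow> real" where
  "hnorm n q = L2_set (\<lambda>i. cmod (q i)) {..<n}"

definition orthonormal :: "nat \<Rightarrow> (nat \<Rightarrow> real) set \<Rightarrow> bool" where
  "orthonormal n E \<longleftrightarrow> finite E \<and>
     (\<forall>a\<in>E. \<forall>b\<in>E. (\<Sum>i<n. a i * b i) = (if a = b then 1 else 0))"

lemma cmod_dot_le: "cmod (dot n p q) \<le> hnorm n p * hnorm n q"
proof -
  have "cmod (dot n p q) \<le> (\<Sum>i<n. \<bar>cmod (p i)\<bar> * \<bar>cmod (q i)\<bar>)"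
    unfolding dot_def by (rule order_trans[OF norm_sum]) (simp add: norm_mult)
  also have "\<dots> \<le> hnorm n p * hnorm n q"
    unfolding hnorm_def by (rule L2_set_mult_ineq)
  finally show ?thesis .
qed

lemma dot_commute: "dot n p q = dot n q p"
  by (simp add: dot_def mult.commute)

text \<open>
  By Bessel's inequality for each unit coordinate vector, the \<open>i\<close>-th coordinates of the members of \<open>E\<close>
  have square sum at most \<open>1\<close>; summing over \<open>i\<close> counts \<open>E\<close>.
\<close>

lemma card_orthonormal_le:
  assumes "orthonormal n E"
  shows "card E \<le> n"
proof -
  have fin: "finite E" and
    on: "(\<Sum>i<n. a i * b i) = (if a = b then 1 else 0)" if "a \<in> E" "b \<in> E" for a b
    using assms that by (auto simp: orthonormal_def)
  have bessel: "(\<Sum>a\<in>E. (a i)\<^sup>2) \<le> 1" if i: "i < n" for i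
  proof -
    let ?s = "\<lambda>k. \<Sum>a\<in>E. a i * a k"
    have "(\<Sum>k<n. (?s k)\<^sup>2) = (\<Sum>k<n. \<Sum>a\<in>E. \<Sum>b\<in>E. (a i * b i) * (a k * b k))"
      by (simp add: power2_eq_square sum_product mult_ac)
    also have "\<dots> = (\<Sum>a\<in>E. \<Sum>b\<in>E. (a i * b i) * (\<Sum>k<n. a k * b k))"
      by (subst sum.swap, rule sum.cong[OF refl], subst sum.swap) (simp add: sum_distrib_left)
    also have "\<dots> = (\<Sum>a\<in>E. \<Sum>b\<in>E. if a = b then a i * b i else 0)"
      by (intro sum.cong refl) (use on in auto)
    also have "\<dots> = (\<Sum>a\<in>E. (a i)\<^sup>2)"
      using fin by (simp add: sum.delta' power2_eq_square)
    finally have 1: "(\<Sum>k<n. (?s k)\<^sup>2) = ?s i"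
      by (simp add: power2_eq_square)
    have "(?s i)\<^sup>2 \<le> (\<Sum>k<n. (?s k)\<^sup>2)"
      using i by (intro member_le_sum) auto
    then have "?s i * ?s i \<le> ?s i * 1" using 1 by (simp add: power2_eq_square)
    moreover have "?s i \<ge> 0" by (intro sum_nonneg) simp
    ultimately have "?s i \<le> 1"
      using mult_strict_left_mono[of 1 "?s i" "?s i"] by linarith
    then show ?thesis by (simp add: power2_eq_square)
  qed
  have "real (card E) = (\<Sum>a\<in>E. \<Sum>i<n. (a i)\<^sup>2)"
    using on by (simp add: power2_eq_square)
  also have "\<dots> = (\<Sum>i<n. \<Sum>a\<in>E. (a i)\<^sup>2)" by (rule sum.swap)
  also have "\<dots> \<le> (\<Sum>i<n. 1)" by (intro sum_mono) (use bessel in auto)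
  finally show ?thesis by simp
qed

text \<open>
  The directions \<open>x\<close> and \<open>y\<close> are real because a real vector orthogonal to a complex vector is orthogonal
  to the real and the imaginary part of the latter. So the plane of a vector that is orthogonal to all
  directions removed before extends these to a larger orthonormal set.
\<close>

definition project_out ::
    "nat \<Rightarrow> (nat \<Rightarrow> real) \<Rightarrow> (nat \<Rightarrow> real) \<Rightarrow> (nat \<Rightarrow> complex) \<Rightarrow> nat \<Rightarrow> complex" where
  "project_out n x y q = (\<lambda>i. q i - dot n (of_real \<circ> x) q * of_real (x i) - dot n (of_real \<circ> y) q * of_real (y i))"

lemma dot_project_out:
  "dot n p (project_out n x y q) =
     dot n p q - dot n (of_real \<circ> x) q * dot n (of_real \<circ> x) p - dot n (of_real \<circ> y) q * dot n (of_real \<circ> y) p"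
proof -
  have "p i * (q i - X * of_real (x i) - Y * of_real (y i))
      = p i * q i - X * (of_real (x i) * p i) - Y * (of_real (y i) * p i)" for i X Y
    by (simp add: algebra_simps)
  then show ?thesis
    by (simp add: dot_def project_out_def sum_subtractf flip: sum_distrib_left)
qed

lemma dot_of_real: "dot n (of_real \<circ> a) (of_real \<circ> b) = of_real (\<Sum>i<n. a i * b i)"
  by (simp add: dot_def)

lemma dot_project_out_frame:
  assumes "(\<Sum>i<n. x i * x i) = 1" "(\<Sum>i<n. y i * y i) = 1" "(\<Sum>i<n. x i * y i) = 0"
  shows "dot n (of_real \<circ> x) (project_out n x y q) = 0"
    and "dot n (of_real \<circ> y) (project_out n x y q) = 0"
    and "dot n (project_out n x y p) (project_out n x y q) =
      dot n p q - dot n (of_real \<circ> x) p * dot n (of_real \<circ> x) q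
                - dot n (of_real \<circ> y) p * dot n (of_real \<circ> y) q"
proof -
  have yx: "(\<Sum>i<n. y i * x i) = 0" using assms(3) by (simp add: mult.commute)
  show 1: "dot n (of_real \<circ> x) (project_out n x y q) = 0" for q
    by (simp add: dot_project_out dot_of_real assms yx)
  show 2: "dot n (of_real \<circ> y) (project_out n x y q) = 0" for q
    by (simp add: dot_project_out dot_of_real assms yx)
  show "dot n (project_out n x y p) (project_out n x y q) =
      dot n p q - dot n (of_real \<circ> x) p * dot n (of_real \<circ> x) q
                - dot n (of_real \<circ> y) p * dot n (of_real \<circ> y) q"
    using 1[of p] 2[of p] dot_project_out[of n "project_out n x y p" x y q]
      dot_project_out[of n q x y p] dot_commute[of n "project_out n x y p" q] dot_commute[of n p q]
    by simp
qed

lemma exists_phase: "\<exists>l. cmod l = 1 \<and> l\<^sup>2 * z = of_real (cmod z)"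
proof (cases "z = 0")
  case True
  then show ?thesis by (intro exI[of _ 1]) simp
next
  case False
  define l where "l = csqrt (of_real (cmod z) / z)"
  have "cmod (l\<^sup>2) = 1" using False by (simp add: l_def norm_divide)
  then have "cmod l = 1" by (simp add: norm_power power2_eq_1_iff) (smt (verit) norm_ge_zero)
  moreover have "l\<^sup>2 * z = of_real (cmod z)" using False by (simp add: l_def)
  ultimately show ?thesis by blast
qed

text \<open>
  Multiplying \<open>z\<close> by a suitable phase makes \<open>dot n z z\<close> a nonnegative real number. Then the real and
  the imaginary part of \<open>l * z\<close> are orthogonal, of lengths \<open>R \<ge> S\<close>, and since \<open>R\<^sup>2 - S\<^sup>2\<close> is small
  compared to \<open>R\<^sup>2 + S\<^sup>2\<close>, neither of them vanishes.
\<close>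

lemma exists_rotated_frame:
  fixes z :: "nat \<Rightarrow> complex"
  assumes "cmod (dot n z z) \<le> c" and "2 * c < (hnorm n z)\<^sup>2"
  obtains x y :: "nat \<Rightarrow> real" and l :: complex and R S :: real
  where "(\<Sum>i<n. x i * x i) = 1" "(\<Sum>i<n. y i * y i) = 1" "(\<Sum>i<n. x i * y i) = 0"
    and "cmod l = 1" "\<And>i. l * z i = of_real R * of_real (x i) + \<i> * of_real S * of_real (y i)"
    and "R > 0" "S > 0" "S \<le> R" "R\<^sup>2 + S\<^sup>2 = (hnorm n z)\<^sup>2" "R\<^sup>2 - S\<^sup>2 \<le> c"
proof -
  obtain l where l: "cmod l = 1" "l\<^sup>2 * dot n z z = of_real (cmod (dot n z z))"
    using exists_phase by blast
  define e where "e = cmod (dot n z z)"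
  define r where "r i = Re (l * z i)" for i
  define s where "s i = Im (l * z i)" for i
  have z: "l * z i = of_real (r i) + \<i> * of_real (s i)" for i
    by (simp add: r_def s_def complex_eq_iff)
  have N: "(hnorm n z)\<^sup>2 = (\<Sum>i<n. r i * r i) + (\<Sum>i<n. s i * s i)"
  proof -
    have "(hnorm n z)\<^sup>2 = (\<Sum>i<n. (cmod (z i))\<^sup>2)"
      by (simp add: hnorm_def L2_set_def sum_nonneg)
    also have "\<dots> = (\<Sum>i<n. (cmod (l * z i))\<^sup>2)" by (simp add: norm_mult l)
    also have "\<dots> = (\<Sum>i<n. r i * r i + s i * s i)"
      unfolding cmod_power2 r_def s_def by (simp only: power2_eq_square)
    finally show ?thesis by (simp add: sum.distrib)
  qed
  have "of_real e = (\<Sum>i<n. (l * z i) * (l * z i))"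
    using l(2) by (simp add: e_def dot_def power2_eq_square sum_distrib_left mult_ac)
  also have "\<dots> = of_real ((\<Sum>i<n. r i * r i) - (\<Sum>i<n. s i * s i)) + \<i> * of_real (2 * (\<Sum>i<n. r i * s i))"
    unfolding z by (simp add: algebra_simps sum.distrib sum_subtractf sum_distrib_left)
  finally have e: "e = (\<Sum>i<n. r i * r i) - (\<Sum>i<n. s i * s i)" and rs: "(\<Sum>i<n. r i * s i) = 0"
    by (auto simp: complex_eq_iff)
  define R where "R = sqrt (\<Sum>i<n. r i * r i)"
  define S where "S = sqrt (\<Sum>i<n. s i * s i)"
  have R2: "R\<^sup>2 = (\<Sum>i<n. r i * r i)" and S2: "S\<^sup>2 = (\<Sum>i<n. s i * s i)"
    by (simp_all add: R_def S_def sum_nonneg)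
  have e0: "0 \<le> e" "e \<le> c" using assms by (simp_all add: e_def)
  have "S\<^sup>2 > 0" using e0 N e assms(2) unfolding R2[symmetric] S2[symmetric] by linarith
  then have S: "S > 0" unfolding S_def by (simp add: S2[unfolded S_def])
  have SR: "S \<le> R" using e e0 by (simp add: R_def S_def)
  have xx: "(\<Sum>i<n. (r i / R) * (r i / R)) = 1"
    using R2 S SR proof -
    have "(\<Sum>i<n. (r i / R) * (r i / R)) = (\<Sum>i<n. r i * r i) / (R * R)"
      by (simp flip: sum_divide_distrib)
    then show ?thesis
      using R2[symmetric] S SR by (simp add: power2_eq_square)
  qed
  have yy: "(\<Sum>i<n. (s i / S) * (s i / S)) = 1"
    using S2 S proof -
    have "(\<Sum>i<n. (s i / S) * (s i / S)) = (\<Sum>i<n. s i * s i) / (S * S)"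
      by (simp flip: sum_divide_distrib)
    then show ?thesis
      using S2[symmetric] S SR by (simp add: power2_eq_square)
  qed
  have xy: "(\<Sum>i<n. (r i / R) * (s i / S)) = 0"
    using rs by (simp flip: sum_divide_distrib)
  show thesis
    by (rule that[of "\<lambda>i. r i / R" "\<lambda>i. s i / S" l R S])
       (use xx yy xy l S SR z N e e0 in \<open>simp_all add: R2 S2\<close>)
qed

text \<open>
  The analytic core. Let \<open>z\<close> be long but nearly isotropic, and let \<open>p\<close> and \<open>q\<close> be no longer than \<open>z\<close> and
  nearly orthogonal to it. In the plane spanned by \<open>z\<close> and its conjugate use the coordinates
  \<open>X + \<i> Y\<close> and \<open>X - \<i> Y\<close>, in which the form is \<open>X X' + Y Y' = ((X + \<i> Y) (X' - \<i> Y') + (X - \<i> Y) (X' + \<i> Y')) / 2\<close>.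
  The first coordinate is essentially \<open>dot n z p\<close> divided by the length of \<open>z\<close>, hence at most of order
  \<open>c\<close> over that length; the second one is at most of the order of that length. Each product is therefore
  of order \<open>c\<close>, and projecting the plane out changes \<open>dot n p q\<close> by a bounded multiple of \<open>c\<close> only.
\<close>

lemma exists_reducing_plane:
  fixes z :: "nat \<Rightarrow> complex"
  assumes "cmod (dot n z z) \<le> c" and "2 * c < (hnorm n z)\<^sup>2"
  obtains x y :: "nat \<Rightarrow> real"
  where "(\<Sum>i<n. x i * x i) = 1" "(\<Sum>i<n. y i * y i) = 1" "(\<Sum>i<n. x i * y i) = 0"
    and "\<And>a. dot n (of_real \<circ> a) z = 0 \<Longrightarrow> (\<Sum>i<n. a i * x i) = 0 \<and> (\<Sum>i<n. a i * y i) = 0"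
    and "\<And>p q. hnorm n p \<le> hnorm n z \<Longrightarrow> cmod (dot n z p) \<le> c \<Longrightarrow>
           hnorm n q \<le> hnorm n z \<Longrightarrow> cmod (dot n z q) \<le> c \<Longrightarrow>
           cmod (dot n p q - dot n (project_out n x y p) (project_out n x y q)) \<le> 12 * c"
proof -
  obtain x y l R S where
    frame: "(\<Sum>i<n. x i * x i) = 1" "(\<Sum>i<n. y i * y i) = 1" "(\<Sum>i<n. x i * y i) = 0"
    and l: "cmod l = 1" "\<And>i. l * z i = of_real R * of_real (x i) + \<i> * of_real S * of_real (y i)"
    and RS: "R > 0" "S > 0" "S \<le> R" "R\<^sup>2 + S\<^sup>2 = (hnorm n z)\<^sup>2" "R\<^sup>2 - S\<^sup>2 \<le> c"
    using exists_rotated_frame[OF assms] by blast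
  have ldot: "l * dot n p z = of_real R * dot n (of_real \<circ> x) p + \<i> * of_real S * dot n (of_real \<circ> y) p" for p
  proof -
    have "l * dot n p z = (\<Sum>i<n. (l * z i) * p i)"
      by (simp add: dot_def sum_distrib_left mult_ac)
    also have "\<dots> = (\<Sum>i<n. of_real R * (of_real (x i) * p i) + \<i> * of_real S * (of_real (y i) * p i))"
      by (simp add: l algebra_simps)
    finally show ?thesis by (simp add: dot_def sum.distrib sum_distrib_left)
  qed
  have perp: "(\<Sum>i<n. a i * x i) = 0 \<and> (\<Sum>i<n. a i * y i) = 0" if "dot n (of_real \<circ> a) z = 0" for a
    using ldot[of "of_real \<circ> a"] that RS dot_of_real[of n x a] dot_of_real[of n y a]
    by (simp add: complex_eq_iff mult.commute)
  have t: "hnorm n z \<le> 2 * R"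
  proof (rule power2_le_imp_le)
    have "S\<^sup>2 \<le> R\<^sup>2" using RS by (intro power_mono) auto
    moreover have "(2 * R)\<^sup>2 = 4 * R\<^sup>2" by (simp add: power_mult_distrib)
    ultimately show "(hnorm n z)\<^sup>2 \<le> (2 * R)\<^sup>2" using RS(4) zero_le_power2[of R] by linarith
  qed (use RS in simp)
  have unit: "hnorm n (of_real \<circ> x) = 1" "hnorm n (of_real \<circ> y) = 1"
    using frame by (simp_all add: hnorm_def L2_set_def power2_eq_square)
  have bounds:
      "cmod (dot n (of_real \<circ> x) p + \<i> * dot n (of_real \<circ> y) p) * R \<le> 3 * c"
      "cmod (dot n (of_real \<circ> x) p - \<i> * dot n (of_real \<circ> y) p) \<le> 4 * R"
    if "hnorm n p \<le> hnorm n z" "cmod (dot n z p) \<le> c" for p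
  proof -
    define X where "X = dot n (of_real \<circ> x) p"
    define Y where "Y = dot n (of_real \<circ> y) p"
    have X: "cmod X \<le> 2 * R" and Y: "cmod Y \<le> 2 * R"
      using cmod_dot_le[of n "of_real \<circ> x" p] cmod_dot_le[of n "of_real \<circ> y" p] unit t that
      by (simp_all add: X_def Y_def)
    have "cmod (X - \<i> * Y) \<le> cmod X + cmod (\<i> * Y)"
      by (rule norm_triangle_ineq4)
    then show "cmod (dot n (of_real \<circ> x) p - \<i> * dot n (of_real \<circ> y) p) \<le> 4 * R"
      using X Y by (simp add: norm_mult flip: X_def Y_def)
    \<comment> \<open>The form \<open>R X + \<i> S Y\<close> is \<open>dot n z p\<close> up to the phase, hence at most \<open>c\<close>. Replacing
        \<open>S\<close> by \<open>R\<close> is harmless because \<open>(R - S) R \<le> R\<^sup>2 - S\<^sup>2\<close>.\<close>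
    have "(X + \<i> * Y) * of_real R = (of_real R * X + \<i> * of_real S * Y) + \<i> * of_real (R - S) * Y"
      by (simp add: algebra_simps)
    also have "of_real R * X + \<i> * of_real S * Y = l * dot n z p"
      using ldot[of p] by (simp add: X_def Y_def dot_commute)
    finally have "cmod ((X + \<i> * Y) * of_real R) \<le> cmod (l * dot n z p) + cmod (\<i> * of_real (R - S) * Y)"
      by (simp add: norm_triangle_ineq)
    then have "cmod (X + \<i> * Y) * R \<le> cmod (dot n z p) + (R - S) * cmod Y"
      using l RS by (simp add: norm_mult flip: of_real_diff)
    also have "(R - S) * cmod Y \<le> (R - S) * (2 * R)"
      using Y RS by (intro mult_left_mono) auto
    also have "\<dots> \<le> 2 * ((R - S) * (R + S))"
      using RS by (simp add: algebra_simps power2_eq_square)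
    also have "\<dots> \<le> 2 * c" using RS by (simp add: algebra_simps power2_eq_square)
    finally show "cmod (dot n (of_real \<circ> x) p + \<i> * dot n (of_real \<circ> y) p) * R \<le> 3 * c"
      using that by (simp add: X_def Y_def)
  qed
  have close: "cmod (dot n p q - dot n (project_out n x y p) (project_out n x y q)) \<le> 12 * c"
    if pq: "hnorm n p \<le> hnorm n z" "cmod (dot n z p) \<le> c" "hnorm n q \<le> hnorm n z" "cmod (dot n z q) \<le> c"
    for p q
  proof -
    define X Y X' Y' where XY: "X = dot n (of_real \<circ> x) p" "Y = dot n (of_real \<circ> y) p"
      "X' = dot n (of_real \<circ> x) q" "Y' = dot n (of_real \<circ> y) q"
    note b = bounds[OF pq(1,2), folded XY] bounds[OF pq(3,4), folded XY]
    have "cmod (X + \<i> * Y) * cmod (X' - \<i> * Y') \<le> cmod (X + \<i> * Y) * (4 * R)"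
      by (intro mult_left_mono b) auto
    also have "\<dots> \<le> 12 * c" using b(1) by (simp add: mult.commute)
    finally have 1: "cmod ((X + \<i> * Y) * (X' - \<i> * Y')) \<le> 12 * c" by (simp add: norm_mult)
    have "cmod (X' + \<i> * Y') * cmod (X - \<i> * Y) \<le> cmod (X' + \<i> * Y') * (4 * R)"
      by (intro mult_left_mono b) auto
    also have "\<dots> \<le> 12 * c" using b(3) by (simp add: mult.commute)
    finally have 2: "cmod ((X' + \<i> * Y') * (X - \<i> * Y)) \<le> 12 * c" by (simp add: norm_mult)
    have "2 * (X * X' + Y * Y') = (X + \<i> * Y) * (X' - \<i> * Y') + (X' + \<i> * Y') * (X - \<i> * Y)"
      by (simp add: algebra_simps)
    then have "cmod (2 * (X * X' + Y * Y')) \<le> 12 * c + 12 * c"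
      using 1 2 by (metis add_mono norm_triangle_le)
    then have "cmod (X * X' + Y * Y') \<le> 12 * c" by (simp only: norm_mult) simp
    then show ?thesis
      by (simp add: dot_project_out_frame[OF frame] flip: XY)
  qed
  show thesis
    using that[OF frame perp close] .
qed

section \<open>Filling cycles of vectors with small products\<close>

definition near :: "nat \<Rightarrow> (nat \<Rightarrow> nat \<Rightarrow> complex) \<Rightarrow> real \<Rightarrow> nat \<Rightarrow> nat \<Rightarrow> bool" where
  "near n q c u w \<longleftrightarrow> cmod (dot n (q u) (q w)) \<le> c"

text \<open>
  In dimension \<open>d\<close>, cycles of dimension at least \<open>d div 2\<close> on at most \<open>N\<close> vertices can be filled with a loss
  of a factor \<open>K\<close> in the bound for the products. The \<open>d\<close>-dimensional space is the orthogonal complement of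
  an orthonormal set \<open>E\<close> of real vectors in the fixed coordinate space of dimension \<open>n\<close>, which avoids a
  change of coordinates whenever the dimension drops. The factor depends neither on \<open>c\<close> nor on the vectors.
\<close>

definition fillable :: "nat \<Rightarrow> nat \<Rightarrow> nat \<Rightarrow> real \<Rightarrow> bool" where
  "fillable n d N K \<longleftrightarrow> 1 \<le> K \<and>
     (\<forall>c E q U m Z. 0 \<le> c \<longrightarrow> orthonormal n E \<longrightarrow> card E + d = n \<longrightarrow>
        (\<forall>u\<in>U. \<forall>a\<in>E. dot n (of_real \<circ> a) (q u) = 0) \<longrightarrow>
        finite U \<longrightarrow> card U \<le> N \<longrightarrow> d div 2 < m \<longrightarrow>
        Poly_Mapping.keys Z \<subseteq> cliques U (near n q c) m \<longrightarrow> aug_boundary Z = 0 \<longrightarrow>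
        (\<exists>Y. Poly_Mapping.keys Y \<subseteq> cliques U (near n q (K * c)) (Suc m) \<and> aug_boundary Y = Z))"

lemma fillableD:
  assumes "fillable n d N K" "0 \<le> c" "orthonormal n E" "card E + d = n"
    "\<And>u a. u \<in> U \<Longrightarrow> a \<in> E \<Longrightarrow> dot n (of_real \<circ> a) (q u) = 0"
    "finite U" "card U \<le> N" "d div 2 < m"
    "Poly_Mapping.keys Z \<subseteq> cliques U (near n q c) m" "aug_boundary Z = 0"
  obtains Y where "Poly_Mapping.keys Y \<subseteq> cliques U (near n q (K * c)) (Suc m)" "aug_boundary Y = Z"
  using assms unfolding fillable_def by blast

lemma near_mono: "near n q c u w \<Longrightarrow> c \<le> c' \<Longrightarrow> near n q c' u w"
  by (simp add: near_def)

lemma near_sym: "near n q c u w \<longleftrightarrow> near n q c w u"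
  by (simp add: near_def dot_commute)

lemma cliques_near_mono: "U \<subseteq> U' \<Longrightarrow> c \<le> c' \<Longrightarrow> cliques U (near n q c) m \<subseteq> cliques U' (near n q c') m"
  by (intro cliques_mono) (auto intro: near_mono)

lemma cliques_empty: "0 < m \<Longrightarrow> cliques {} R m = {}"
  by (auto simp: cliques_def)

text \<open>
  Induction on the dimension and the number of vertices. Let \<open>v\<close> be the vertex with the longest vector.
  If that length is at most of order \<open>sqrt c\<close>, then all products are small, every set of vertices is a
  clique, and a cone fills the cycle. If the vector at \<open>v\<close> has a square larger than \<open>c\<close>, then \<open>v\<close>
  does not occur in the cycle. Otherwise \<open>v\<close> is nearly isotropic and all its neighbours are nearly
  orthogonal to it, so that in the link of \<open>v\<close> the products are up to a bounded multiple of \<open>c\<close>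
  those of vectors in dimension \<open>d - 2\<close>. The link of a cycle has one dimension less, and
  \<open>(d - 2) div 2 = d div 2 - 1\<close>, hence it can be filled and \<open>v\<close> removed. A plane of removed directions
  always fits into the space, so that this last case cannot occur for \<open>d < 2\<close>.
\<close>

lemma exists_fillable: "\<exists>K. fillable n d N K"
proof (induction d arbitrary: N rule: less_induct)
  case (less d)
  show ?case
  proof (induction N)
    case 0
    have "fillable n d 0 1"
      unfolding fillable_def
    proof (intro conjI allI impI)
      fix c E q U m and Z :: "nat list \<Rightarrow>\<^sub>0 int"
      assume "finite (U :: nat set)" "card U \<le> 0" "d div 2 < m"
        "Poly_Mapping.keys Z \<subseteq> cliques U (near n q c) m"
      then have "Z = 0" using cliques_empty[of m "near n q c"] by simp
      then show "\<exists>Y. Poly_Mapping.keys Y \<subseteq> cliques U (near n q (1 * c)) (Suc m) \<and> aug_boundary Y = Z"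
        by (intro exI[of _ 0]) simp
    qed simp
    then show ?case by blast
  next
    case (Suc N)
    obtain K2 where K2: "fillable n d N K2" using Suc by blast
    obtain K1 where K1: "2 \<le> d \<Longrightarrow> fillable n (d - 2) N K1" and K1': "1 \<le> K1"
      using less.IH[of "d - 2" N] unfolding fillable_def
      by (cases "2 \<le> d") (auto, metis order_refl)
    have K2': "1 \<le> K2" using K2 by (simp add: fillable_def)
    \<comment> \<open>The products in the link grow from \<open>c\<close> to \<open>13 c\<close> under the projection, are multiplied by \<open>K1\<close>
        by the filling, and grow by \<open>12 c\<close> when the projection is undone.\<close>
    define L where "L = 13 * K1 + 12"
    define K where "K = K2 * L"
    have L1: "1 \<le> L" using K1' by (simp add: L_def)
    have LK: "L \<le> K" "K2 \<le> K"
      unfolding K_def using L1 K2' mult_mono[of 1 K2 L L] mult_mono[of K2 K2 1 L] by auto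
    then have LK: "L \<le> K" "K2 \<le> K" "2 \<le> K"
      using K1' by (auto simp: L_def)
    have "fillable n d (Suc N) K"
      unfolding fillable_def
    proof (intro conjI allI impI)
      show "1 \<le> K" using LK by simp
    next
      fix c E q U m and Z :: "nat list \<Rightarrow>\<^sub>0 int"
      assume c: "0 \<le> c" and E: "orthonormal n E" "card E + d = n"
        and perp: "\<forall>u\<in>U. \<forall>a\<in>E. dot n (of_real \<circ> a) (q u) = 0"
        and U: "finite U" "card U \<le> Suc N" and m: "d div 2 < m"
        and Z: "Poly_Mapping.keys Z \<subseteq> cliques U (near n q c) m" and bd: "aug_boundary Z = 0"
      have scale: "a * c \<le> b * c" if "a \<le> b" for a b using that c by (rule mult_right_mono)
      show "\<exists>Y. Poly_Mapping.keys Y \<subseteq> cliques U (near n q (K * c)) (Suc m) \<and> aug_boundary Y = Z"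
      proof (cases "U = {}")
        case True
        then have "Z = 0" using Z m cliques_empty[of m "near n q c"] by simp
        then show ?thesis by (intro exI[of _ 0]) simp
      next
        case False
        let ?norms = "(\<lambda>u. hnorm n (q u)) ` U"
        have "Max ?norms \<in> ?norms" using U False by (intro Max_in) auto
        then obtain v where v: "v \<in> U" "hnorm n (q v) = Max ?norms" by auto
        then have vmax: "hnorm n (q u) \<le> hnorm n (q v)" if "u \<in> U" for u
          using that U by simp
        have incZ: "increasing Z" by (rule increasing_cliques[OF Z])
        consider (small) "(hnorm n (q v))\<^sup>2 \<le> 2 * c"
          | (skip) "\<not> near n q c v v"
          | (large) "2 * c < (hnorm n (q v))\<^sup>2" "near n q c v v"
          by linarith
        then show ?thesis
        proof cases
          case small
          have all: "near n q (K * c) u w" if "u \<in> U" "w \<in> U" for u w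
          proof -
            have "cmod (dot n (q u) (q w)) \<le> hnorm n (q v) * hnorm n (q v)"
              by (rule order_trans[OF cmod_dot_le])
                 (intro mult_mono vmax that, auto simp: hnorm_def)
            also have "\<dots> \<le> K * c"
              using small scale[OF LK(3)] by (simp add: power2_eq_square)
            finally show ?thesis by (simp add: near_def)
          qed
          have "Poly_Mapping.keys Z \<subseteq> cliques U (near n q (K * c)) m"
            using Z scale[of 1 K] LK cliques_near_mono[of U U c "K * c"] by fastforce
          then have "Poly_Mapping.keys (wedge v Z) \<subseteq> cliques U (near n q (K * c)) (Suc m)"
            by (rule wedge_cliques) (use v all in auto)
          moreover have "aug_boundary (wedge v Z) = Z"
            using aug_boundary_wedge[OF incZ] bd by simp
          ultimately show ?thesis by blast
        next
          case skip
          have Z': "Poly_Mapping.keys Z \<subseteq> cliques (U - {v}) (near n q c) m"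
            using Z skip unfolding cliques_def by blast
          obtain Y where "Poly_Mapping.keys Y \<subseteq> cliques (U - {v}) (near n q (K2 * c)) (Suc m)"
              "aug_boundary Y = Z"
            by (rule fillableD[OF K2 c E _ _ _ m Z' bd]) (use perp U v in auto)
          then show ?thesis
            using cliques_near_mono[of "U - {v}" U "K2 * c" "K * c" n q "Suc m"] scale[OF LK(2)]
            by blast
        next
          case large
          obtain x y where
            frame: "(\<Sum>i<n. x i * x i) = 1" "(\<Sum>i<n. y i * y i) = 1" "(\<Sum>i<n. x i * y i) = 0"
            and xyE: "\<And>a. dot n (of_real \<circ> a) (q v) = 0 \<Longrightarrow>
                (\<Sum>i<n. a i * x i) = 0 \<and> (\<Sum>i<n. a i * y i) = 0"
            and close: "\<And>p r. hnorm n p \<le> hnorm n (q v) \<Longrightarrow> cmod (dot n (q v) p) \<le> c \<Longrightarrow>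
                hnorm n r \<le> hnorm n (q v) \<Longrightarrow> cmod (dot n (q v) r) \<le> c \<Longrightarrow>
                cmod (dot n p r - dot n (project_out n x y p) (project_out n x y r)) \<le> 12 * c"
            using exists_reducing_plane[of n "q v" c] large by (auto simp: near_def)
          define E' where "E' = insert x (insert y E)"
          define w where "w u = project_out n x y (q u)" for u
          define U' where "U' = {u \<in> U - {v}. near n q c v u \<and> near n q c u u}"
          have Exy: "(\<Sum>i<n. a i * x i) = 0" "(\<Sum>i<n. a i * y i) = 0" "(\<Sum>i<n. x i * a i) = 0" 
              "(\<Sum>i<n. y i * a i) = 0" if "a \<in> E" for a
            using xyE[of a] perp v that by (auto simp: mult.commute)
          have new: "x \<notin> E" "y \<notin> E" "x \<noteq> y"
            using Exy(1)[of x] Exy(2)[of y] frame by auto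
          have E': "orthonormal n E'"
            using E(1) Exy new frame unfolding orthonormal_def E'_def by (auto simp: mult.commute)
          have card: "card E' = card E + 2"
            using E(1) new by (simp add: E'_def orthonormal_def)
          then have d: "2 \<le> d" using card_orthonormal_le[OF E'] E(2) by linarith
          obtain k where k: "m = Suc k" using m by (cases m) auto
          have closeU: "cmod (dot n (q u) (q u') - dot n (w u) (w u')) \<le> 12 * c"
            if "u \<in> U'" "u' \<in> U'" for u u'
            unfolding w_def using that vmax by (intro close) (auto simp: U'_def near_def)
          have near_w: "near n w (13 * c) u u'" if "near n q c u u'" "u \<in> U'" "u' \<in> U'" for u u'
            using closeU[OF that(2,3)] that(1) norm_triangle_sub[of "dot n (w u) (w u')" "dot n (q u) (q u')"]
            by (simp add: near_def norm_minus_commute)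
          have near_q: "near n q (L * c) u u'" if "near n w (K1 * (13 * c)) u u'" "u \<in> U'" "u' \<in> U'" for u u'
            using closeU[OF that(2,3)] that(1) norm_triangle_sub[of "dot n (q u) (q u')" "dot n (w u) (w u')"]
            by (simp add: near_def L_def algebra_simps)
          have "Poly_Mapping.keys (contract v Z) \<subseteq> cliques U' (near n q c) k"
            using contract_cliques[of Z U "near n q c" k v] Z k by (simp add: U'_def)
          also have "\<dots> \<subseteq> cliques U' (near n w (13 * c)) k"
            by (rule cliques_mono) (use near_w in auto)
          finally have A: "Poly_Mapping.keys (contract v Z) \<subseteq> cliques U' (near n w (13 * c)) k" .
          have perp': "dot n (of_real \<circ> a) (w u) = 0" if u: "u \<in> U'" and a: "a \<in> E'" for u a
          proof -
            consider "a = x" | "a = y" | "a \<in> E" using a by (auto simp: E'_def)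
            then show ?thesis
            proof cases
              case 3
              then show ?thesis
                using perp u Exy[OF 3]
                by (simp add: w_def dot_project_out dot_of_real U'_def flip: of_real_mult of_real_sum)
            qed (simp_all add: w_def dot_project_out_frame[OF frame])
          qed
          obtain Y1 where Y1: "Poly_Mapping.keys Y1 \<subseteq> cliques U' (near n w (K1 * (13 * c))) (Suc k)"
              "aug_boundary Y1 = contract v Z"
          proof (rule fillableD[OF K1[OF d] _ E' _ perp' _ _ _ A])
            show "aug_boundary (contract v Z) = 0" using aug_boundary_contract[OF incZ] bd by simp
            have "U' \<subseteq> U - {v}" by (auto simp: U'_def)
            then show "finite U'" "card U' \<le> N"
              using U v card_mono[of "U - {v}" U'] finite_subset by auto
            show "(d - 2) div 2 < k" using m d k by (cases d; cases "d - 1") auto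
          qed (use c card d E in auto)
          have Y1'': "Poly_Mapping.keys Y1 \<subseteq> cliques U' (near n q (L * c)) m"
            using Y1(1) near_q cliques_mono[of U' U' "near n w (K1 * (13 * c))" "near n q (L * c)" "Suc k"] k
            by blast
          have near_v: "near n q (L * c) v u" if "near n q c v u" for u
            using near_mono[OF that] scale[OF L1] by simp
          have wY1: "Poly_Mapping.keys (wedge v Y1) \<subseteq> cliques U (near n q (L * c)) (Suc m)"
          proof (rule wedge_cliques[OF Y1''])
            show "insert v U' \<subseteq> U" using v by (auto simp: U'_def)
            show "near n q (L * c) v v" using near_v large(2) .
            show "near n q (L * c) u v \<and> near n q (L * c) v u" if "u \<in> U'" for u
              using near_v[of u] near_sym[of n q "L * c" u v] that by (simp add: U'_def)
          qed
          have Y1': "Poly_Mapping.keys Y1 \<subseteq> cliques (U - {v}) (near n q (L * c)) m"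
            by (rule order_trans[OF Y1''], rule cliques_mono) (auto simp: U'_def)
          define Z' where "Z' = contract v (wedge v Z) + Y1"
          have Z': "aug_boundary Z' = 0" "Z = Z' - aug_boundary (wedge v Y1)"
            using fill_by_removing_vertex[OF incZ increasing_cliques[OF Y1(1)] bd Y1(2)] by (simp_all add: Z'_def)
          have "Poly_Mapping.keys (contract v (wedge v Z)) \<subseteq> cliques (U - {v}) (near n q (L * c)) m"
            using contract_wedge_cliques[OF Z, of v] scale[OF L1]
              cliques_near_mono[of "U - {v}" "U - {v}" c "L * c" n q m] by auto
          then have keysZ': "Poly_Mapping.keys Z' \<subseteq> cliques (U - {v}) (near n q (L * c)) m"
            using Y1' keys_add[of "contract v (wedge v Z)" Y1] by (auto simp: Z'_def)
          obtain Y2 where Y2: "Poly_Mapping.keys Y2 \<subseteq> cliques (U - {v}) (near n q (K2 * (L * c))) (Suc m)"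
              "aug_boundary Y2 = Z'"
            by (rule fillableD[OF K2 _ E _ _ _ m keysZ' Z'(1)]) (use perp U v c L1 in auto)
          have "Poly_Mapping.keys (Y2 - wedge v Y1) \<subseteq> cliques U (near n q (K * c)) (Suc m)"
            using Y2(1) wY1 keys_diff[of Y2 "wedge v Y1"] scale[OF LK(1)]
              cliques_near_mono[of "U - {v}" U "K2 * (L * c)" "K * c" n q "Suc m"]
              cliques_near_mono[of U U "L * c" "K * c" n q "Suc m"]
            by (simp add: K_def mult.assoc) blast
          moreover have "aug_boundary (Y2 - wedge v Y1) = Z"
            using Y2(2) Z'(2) by simp
          ultimately show ?thesis by blast
        qed
      qed
    qed
    then show ?case by blast
  qed
qed

section \<open>From edge lengths to products\<close>

text \<open>
  The map of the Euclidean space into the isotropic cone of a space with two more dimensions, known from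
  conformal geometry. It turns squared distances into products of vectors: for points with squares \<open>s\<close>
  and \<open>t\<close>, the two additional coordinates contribute \<open>s + t\<close> and the other ones \<open>- 2\<close> times the product
  of the points.
\<close>

definition conformal_lift :: "nat \<Rightarrow> complex vec \<Rightarrow> nat \<Rightarrow> complex" where
  "conformal_lift n p i =
     (let s = \<Sum>j<n. (p $ j)\<^sup>2 in
      if i < n then \<i> * of_real (sqrt 2) * p $ i
      else if i = n then (1 + s) / of_real (sqrt 2)
      else \<i> * (1 - s) / of_real (sqrt 2))"

lemma of_real_sqrt2: "complex_of_real (sqrt 2) * complex_of_real (sqrt 2) = 2"
  by (simp flip: of_real_mult)

lemma dot_conformal_lift: "dot (n + 2) (conformal_lift n (P u)) (conformal_lift n (P v)) = sq_edge_length n P u v"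
proof -
  define s where "s = (\<Sum>j<n. (P u $ j)\<^sup>2)"
  define t where "t = (\<Sum>j<n. (P v $ j)\<^sup>2)"
  define r where "r = complex_of_real (sqrt 2)"
  have r: "r * r = 2" by (simp add: r_def of_real_sqrt2)
  have "dot (n + 2) (conformal_lift n (P u)) (conformal_lift n (P v)) =
      (\<Sum>i<n. (\<i> * r * P u $ i) * (\<i> * r * P v $ i))
      + ((1 + s) / r) * ((1 + t) / r) + (\<i> * (1 - s) / r) * (\<i> * (1 - t) / r)"
    by (simp add: dot_def conformal_lift_def Let_def s_def t_def r_def)
  also have "(\<Sum>i<n. (\<i> * r * P u $ i) * (\<i> * r * P v $ i)) = (\<Sum>i<n. - 2 * (P u $ i * P v $ i))"
  proof (rule sum.cong[OF refl])
    fix i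
    have "(\<i> * r * P u $ i) * (\<i> * r * P v $ i) = (r * r) * - (P u $ i * P v $ i)"
      by (simp add: algebra_simps)
    then show "(\<i> * r * P u $ i) * (\<i> * r * P v $ i) = - 2 * (P u $ i * P v $ i)"
      by (simp add: r)
  qed
  also have "((1 + s) / r) * ((1 + t) / r) = (1 + s) * (1 + t) / 2"
    using r by (simp add: times_divide_times_eq)
  also have "(\<i> * (1 - s) / r) * (\<i> * (1 - t) / r) = - ((1 - s) * (1 - t)) / 2"
    using r by (simp add: times_divide_times_eq algebra_simps)
  finally have "dot (n + 2) (conformal_lift n (P u)) (conformal_lift n (P v)) =
      (\<Sum>i<n. - 2 * (P u $ i * P v $ i)) + ((1 + s) * (1 + t) / 2 + - ((1 - s) * (1 - t)) / 2)"
    by (simp only: add.assoc)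
  also have "(1 + s) * (1 + t) / 2 + - ((1 - s) * (1 - t)) / 2 = s + t"
    by (simp add: field_simps)
  also have "(\<Sum>i<n. - 2 * (P u $ i * P v $ i)) + (s + t) = sq_edge_length n P u v"
    by (simp add: sq_edge_length_def s_def t_def power2_diff sum.distrib sum_subtractf sum_negf algebra_simps sum_distrib_left)
  finally show ?thesis .
qed

text \<open>
  The lifted points live in dimension \<open>n + 2\<close>, where cycles of dimension at least \<open>(n + 2) div 2\<close> can be
  filled. For cycles of dimension \<open>n - 1\<close> this is exactly the condition \<open>n \<ge> 3\<close>.
\<close>

lemma bounded_filling:
  assumes "3 \<le> n"
  shows "\<exists>K\<ge>1. \<forall>c\<ge>0. \<forall>P Z.
    Poly_Mapping.keys Z \<subseteq> cliques {..M} (\<lambda>u v. cmod (sq_edge_length n P u v) \<le> c) n \<longrightarrow>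
    aug_boundary Z = 0 \<longrightarrow>
    (\<exists>Y. Poly_Mapping.keys Y \<subseteq> cliques {..M} (\<lambda>u v. cmod (sq_edge_length n P u v) \<le> K * c) (Suc n) \<and>
         aug_boundary Y = Z)"
proof -
  obtain K where K: "fillable (n + 2) (n + 2) (Suc M) K" using exists_fillable by blast
  have R: "(\<lambda>u v. cmod (sq_edge_length n P u v) \<le> c) = near (n + 2) (\<lambda>u. conformal_lift n (P u)) c" for P c
    by (simp add: fun_eq_iff near_def dot_conformal_lift del: add_2_eq_Suc')
  show ?thesis
    unfolding R
  proof (intro exI[of _ K] conjI allI impI)
    show "1 \<le> K" using K by (simp add: fillable_def)
  next
    fix c :: real and P Z
    assume *: "0 \<le> c" "Poly_Mapping.keys Z \<subseteq> cliques {..M} (near (n + 2) (\<lambda>u. conformal_lift n (P u)) c) n"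
      "aug_boundary Z = 0"
    obtain Y where "Poly_Mapping.keys Y \<subseteq> cliques {..M} (near (n + 2) (\<lambda>u. conformal_lift n (P u)) (K * c)) (Suc n)"
      "aug_boundary Y = Z"
      by (rule fillableD[OF K *(1) _ _ _ _ _ _ *(2,3), of "{}"])
         (use assms in \<open>auto simp: orthonormal_def\<close>)
    then show "\<exists>Y. Poly_Mapping.keys Y \<subseteq> cliques {..M} (near (n + 2) (\<lambda>u. conformal_lift n (P u)) (K * c)) (Suc n) \<and>
        aug_boundary Y = Z" by blast
  qed
qed

section \<open>The volume of a simplex\<close>

lemma norm_det_le:
  fixes A :: "complex mat"
  assumes A: "A \<in> carrier_mat n n" and b: "\<And>i j. i < n \<Longrightarrow> j < n \<Longrightarrow> cmod (A $$ (i, j)) \<le> b"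
  shows "cmod (det A) \<le> fact n * b ^ n"
proof -
  have "cmod (det A) \<le> (\<Sum>p | p permutes {0..<n}. cmod (signof p * (\<Prod>i = 0..<n. A $$ (i, p i))))"
    unfolding det_def'[OF A] by (rule norm_sum)
  also have "\<dots> \<le> (\<Sum>p | p permutes {0..<n}. b ^ n)"
  proof (rule sum_mono)
    fix p assume "p \<in> {p. p permutes {0..<n}}"
    then have p: "p permutes {0..<n}" by simp
    have "cmod (signof p * (\<Prod>i = 0..<n. A $$ (i, p i))) = (\<Prod>i = 0..<n. cmod (A $$ (i, p i)))"
      by (simp add: norm_mult prod_norm sign_def)
    also have "\<dots> \<le> (\<Prod>i = 0..<n. b)"
    proof (rule prod_mono)
      fix i assume i: "i \<in> {0..<n}"
      then have "p i < n" using permutes_in_image[OF p, of i] by simp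
      then show "0 \<le> cmod (A $$ (i, p i)) \<and> cmod (A $$ (i, p i)) \<le> b" using b i by simp
    qed
    finally show "cmod (signof p * (\<Prod>i = 0..<n. A $$ (i, p i))) \<le> b ^ n" by simp
  qed
  also have "\<dots> = fact n * b ^ n" by (simp add: card_permutations[OF refl])
  finally show ?thesis .
qed

text \<open>
  Both sides are expansions of the determinant whose columns are the vertices with an additional
  coordinate \<open>1\<close>: the left one along the row of ones, the right one along the first column after
  translating the first vertex to the origin.
\<close>

lemma face_volume_sum:
  assumes len: "length xs = Suc n"
  shows "(\<Sum>j<Suc n. (-1) ^ j * det (mat_of_cols n (map P (take j xs @ drop (Suc j) xs))))
       = det (mat n n (\<lambda>(i, j). P (xs ! Suc j) $ i - P (xs ! 0) $ i :: complex))"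
proof -
  define A where "A = mat (Suc n) (Suc n) (\<lambda>(i, j). if i = 0 then 1 else P (xs ! j) $ (i - 1))"
  define B where "B = mat (Suc n) (Suc n)
     (\<lambda>(i, j). if i = 0 then 1 else P (xs ! j) $ (i - 1) - P (xs ! 0) $ (i - 1))"
  define L where "L = mat (Suc n) (Suc n)
     (\<lambda>(i, j). if i = j then 1 else if j = 0 then - (P (xs ! 0) $ (i - 1)) else 0)"
  have carr: "A \<in> carrier_mat (Suc n) (Suc n)" "B \<in> carrier_mat (Suc n) (Suc n)"
      "L \<in> carrier_mat (Suc n) (Suc n)"
    by (auto simp: A_def B_def L_def)
  have "B = L * A"
  proof (rule eq_matI)
    fix i j assume "i < dim_row (L * A)" "j < dim_col (L * A)"
    then have ij: "i < Suc n" "j < Suc n" using carr by auto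
    have "(L * A) $$ (i, j) = (\<Sum>k\<in>{0..<Suc n}. L $$ (i, k) * A $$ (k, j))"
      using ij carr by (simp add: times_mat_def scalar_prod_def)
    also have "\<dots> = (\<Sum>k\<in>{0..<Suc n}. (if k = i then A $$ (i, j) else 0) +
         (if k = 0 then (if i = 0 then 0 else - (P (xs ! 0) $ (i - 1))) else 0))"
      by (rule sum.cong) (use ij in \<open>auto simp: L_def A_def\<close>)
    also have "\<dots> = A $$ (i, j) + (if i = 0 then 0 else - (P (xs ! 0) $ (i - 1)))"
      using ij by (simp add: sum.distrib)
    finally show "B $$ (i, j) = (L * A) $$ (i, j)"
      using ij by (simp add: A_def B_def)
  qed (use carr in auto)
  moreover have "det L = 1"
  proof -
    have "det L = prod_list (diag_mat L)"
      by (rule det_lower_triangular[OF _ carr(3)]) (auto simp: L_def)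
    also have "\<dots> = 1"
      unfolding prod_list_diag_prod by (rule prod.neutral) (auto simp: L_def)
    finally show ?thesis .
  qed
  ultimately have det: "det B = det A" using det_mult[OF carr(3,1)] by simp
  have del: "mat_delete A 0 j = mat_of_cols n (map P (take j xs @ drop (Suc j) xs))"
    if "j < Suc n" for j
    by (rule eq_matI)
       (use that len in \<open>auto simp: mat_delete_def A_def mat_of_cols_def nth_append min_def\<close>)
  have "det A = (\<Sum>j<Suc n. A $$ (0, j) * cofactor A 0 j)"
    by (rule laplace_expansion_row[OF carr(1)]) simp
  also have "\<dots> = (\<Sum>j<Suc n. (-1) ^ j * det (mat_of_cols n (map P (take j xs @ drop (Suc j) xs))))"
    by (rule sum.cong) (auto simp: cofactor_def del, simp add: A_def)
  finally have 1: "det A = (\<Sum>j<Suc n. (-1) ^ j * det (mat_of_cols n (map P (take j xs @ drop (Suc j) xs))))" .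
  have "det B = (\<Sum>i<Suc n. B $$ (i, 0) * cofactor B i 0)"
    by (rule laplace_expansion_column[OF carr(2)]) simp
  also have "\<dots> = (\<Sum>i<Suc n. if i = 0 then cofactor B 0 0 else 0)"
    by (rule sum.cong) (auto simp: B_def)
  also have "\<dots> = det (mat_delete B 0 0)" by (simp add: cofactor_def sum.delta)
  also have "mat_delete B 0 0 = mat n n (\<lambda>(i, j). P (xs ! Suc j) $ i - P (xs ! 0) $ i)"
    by (rule eq_matI) (auto simp: mat_delete_def B_def)
  finally show ?thesis using 1 det by simp
qed

text \<open>
  The square of the determinant is the Gram determinant of the edge vectors at the first vertex, whose
  entries are combinations of three squared edge lengths by the law of cosines.
\<close>

lemma norm_edge_det_le:
  assumes edges: "\<And>i j. i \<le> n \<Longrightarrow> j \<le> n \<Longrightarrow> cmod (sq_edge_length n P (xs ! i) (xs ! j)) \<le> c"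
  shows "(cmod (det (mat n n (\<lambda>(i, j). P (xs ! Suc j) $ i - P (xs ! 0) $ i))))\<^sup>2 \<le> fact n * (3 / 2 * c) ^ n"
proof -
  define D where "D = mat n n (\<lambda>(i, j). P (xs ! Suc j) $ i - P (xs ! 0) $ i)"
  have D: "D \<in> carrier_mat n n" by (simp add: D_def)
  have gram: "cmod ((D\<^sup>T * D) $$ (j, k)) \<le> 3 / 2 * c" if jk: "j < n" "k < n" for j k
  proof -
    let ?l = "\<lambda>a b. sq_edge_length n P (xs ! a) (xs ! b)"
    have "(D\<^sup>T * D) $$ (j, k) = (\<Sum>i<n. (P (xs ! Suc j) $ i - P (xs ! 0) $ i) * (P (xs ! Suc k) $ i - P (xs ! 0) $ i))"
      using jk by (simp add: D_def times_mat_def scalar_prod_def atLeast0LessThan)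
    also have "2 * \<dots> = ?l (Suc j) 0 + ?l (Suc k) 0 - ?l (Suc j) (Suc k)"
      unfolding sq_edge_length_def sum_distrib_left sum.distrib[symmetric] sum_subtractf[symmetric]
      by (rule sum.cong) (auto simp: power2_eq_square algebra_simps)
    finally have "2 * cmod ((D\<^sup>T * D) $$ (j, k)) = cmod (?l (Suc j) 0 + ?l (Suc k) 0 - ?l (Suc j) (Suc k))"
      by (metis norm_mult norm_numeral)
    also have "\<dots> \<le> c + c + c"
      using jk by (intro norm_triangle_le_diff norm_triangle_le add_mono edges) auto
    finally show ?thesis by simp
  qed
  have "(cmod (det D))\<^sup>2 = cmod (det (D\<^sup>T * D))"
    using det_mult[of "D\<^sup>T" n D] D det_transpose[OF D] by (simp add: norm_mult power2_eq_square)
  also have "\<dots> \<le> fact n * (3 / 2 * c) ^ n"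
    by (rule norm_det_le[OF _ gram]) (use D in auto)
  finally show ?thesis by (simp add: D_def)
qed

section \<open>The volume of a cycle\<close>

lemma oriented_volume_zero [simp]: "oriented_volume n 0 P = 0"
  by (simp add: oriented_volume_def)

lemma oriented_volume_frag_of: "oriented_volume n (frag_of xs) P = det (mat_of_cols n (map P xs)) / fact n"
  by (simp add: oriented_volume_def)

lemma oriented_volume_sum:
  "finite I \<Longrightarrow> oriented_volume n (\<Sum>i\<in>I. f i) P = (\<Sum>i\<in>I. oriented_volume n (f i) P)"
  by (induction I rule: finite_induct) (simp_all add: oriented_volume_add)

lemma oriented_volume_frag_extend:
  "oriented_volume n (frag_extend b c) P =
     (\<Sum>xs\<in>Poly_Mapping.keys c. of_int (Poly_Mapping.lookup c xs) * oriented_volume n (b xs) P)"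
  by (simp add: frag_extend_def oriented_volume_sum oriented_volume_cmul)

lemma sqrt_power_eq_powr:
  assumes "0 \<le> c" "0 < n"
  shows "sqrt (c ^ n) = c powr (real n / 2)"
proof (cases "c = 0")
  case False
  then have "sqrt (c ^ n) = (c powr real n) powr (1 / 2)"
    using assms by (simp add: powr_half_sqrt powr_realpow)
  then show ?thesis by (simp add: powr_powr)
qed (use assms in simp)

lemma norm_face_volume_le:
  assumes "xs \<in> cliques U (\<lambda>u v. cmod (sq_edge_length n P u v) \<le> K * c) (Suc n)"
    and "0 \<le> c" "0 \<le> K" "0 < n"
  shows "cmod (oriented_volume n (face_sum xs) P) \<le> sqrt (fact n * (3 / 2 * K) ^ n) * c powr (real n / 2)"
proof -
  define D where "D = det (mat n n (\<lambda>(i, j). P (xs ! Suc j) $ i - P (xs ! 0) $ i))"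
  have len: "length xs = Suc n" using assms(1) by (simp add: cliques_def)
  have "oriented_volume n (face_sum xs) P = D / fact n"
    unfolding D_def face_volume_sum[OF len, symmetric] face_sum_eq_sum len
    by (simp add: oriented_volume_sum oriented_volume_cmul oriented_volume_frag_of
        sum_divide_distrib add_divide_distrib del: sum.lessThan_Suc)
  then have "cmod (oriented_volume n (face_sum xs) P) = cmod D / fact n"
    by (simp add: norm_divide)
  also have "\<dots> \<le> cmod D"
    using fact_ge_1[of n] by (simp add: divide_le_eq mult_le_cancel_left1)
  also have "\<dots> \<le> sqrt (fact n * (3 / 2 * (K * c)) ^ n)"
    unfolding D_def
    by (rule real_le_rsqrt, rule norm_edge_det_le) (use assms(1) len in \<open>auto simp: cliques_def\<close>)
  also have "\<dots> = sqrt (fact n * (3 / 2 * K) ^ n) * sqrt (c ^ n)"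
    by (simp only: mult.assoc[symmetric] real_sqrt_mult power_mult_distrib)
  also have "sqrt (c ^ n) = c powr (real n / 2)"
    by (rule sqrt_power_eq_powr) (use assms in auto)
  finally show ?thesis .
qed

lemma max_sq_edge_length_bounds:
  assumes "Poly_Mapping.keys Z \<subseteq> simplex_faces M k" "1 \<le> k"
  shows "0 \<le> max_sq_edge_length n Z P"
    and "\<lbrakk>xs \<in> Poly_Mapping.keys Z; u \<in> set xs; v \<in> set xs\<rbrakk> \<Longrightarrow>
      cmod (sq_edge_length n P u v) \<le> max_sq_edge_length n Z P"
proof -
  define E where "E = {cmod (sq_edge_length n P u v) | u v. u \<noteq> v \<and> {u, v} \<in> supp Z}"
  have "E \<subseteq> (\<lambda>(u, v). cmod (sq_edge_length n P u v)) ` ({..M} \<times> {..M})"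
    using assms(1) by (fastforce simp: E_def supp_def simplex_faces_def)
  then have fin: "finite E" by (rule finite_subset) simp
  have pos: "0 \<le> max_sq_edge_length n Z P"
  proof (cases "Z = 0")
    case False
    then obtain xs where xs: "xs \<in> Poly_Mapping.keys Z" by fastforce
    then have "sorted_wrt (<) xs" "2 \<le> length xs"
      using assms by (auto simp: simplex_faces_def)
    then obtain a b ys where "xs = a # b # ys" "a < b"
      by (cases xs; cases "tl xs") auto
    then have "cmod (sq_edge_length n P a b) \<in> E"
      using xs by (force simp: E_def supp_def)
    then have "cmod (sq_edge_length n P a b) \<le> Max E" using fin by simp
    then have "0 \<le> Max E" by (rule order_trans[OF norm_ge_zero])
    then show ?thesis using False by (simp add: max_sq_edge_length_def E_def)
  qed (simp add: max_sq_edge_length_def)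
  then show "0 \<le> max_sq_edge_length n Z P" .
  assume xs: "xs \<in> Poly_Mapping.keys Z" "u \<in> set xs" "v \<in> set xs"
  show "cmod (sq_edge_length n P u v) \<le> max_sq_edge_length n Z P"
  proof (cases "u = v")
    case True
    then show ?thesis using pos by (simp add: sq_edge_length_def)
  next
    case False
    then have "cmod (sq_edge_length n P u v) \<in> E"
      using xs by (force simp: E_def supp_def)
    then have "cmod (sq_edge_length n P u v) \<le> Max E" using fin by simp
    moreover have "Z \<noteq> 0" using xs by auto
    ultimately show ?thesis by (simp add: max_sq_edge_length_def E_def)
  qed
qed

text \<open>
  A filling of \<open>Z\<close> may depend on \<open>P\<close>, and so may its coefficients. However, only finitely many sets of
  \<open>n\<close>-faces can be the clique complex of the short edges; choosing one filling for each set that admits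
  one bounds the coefficients uniformly.
\<close>

theorem corollary8p1:
  fixes n M :: nat and Z :: "nat list \<Rightarrow>\<^sub>0 int"
  assumes "n \<ge> 3" and "Z \<in> cycles M (n - 1)"
  shows "\<exists>C :: real. \<forall>P :: nat \<Rightarrow> complex vec. polyhedron n Z P \<longrightarrow>
           cmod (oriented_volume n Z P) \<le> C * max_sq_edge_length n Z P powr (real n / 2)"
proof -
  have keysZ: "Poly_Mapping.keys Z \<subseteq> simplex_faces M (n - 1)" and "boundary Z = 0"
    using assms by (auto simp: cycles_def chains_def)
  then have bd: "aug_boundary Z = 0"
    using boundary_eq_aug_boundary[of Z] assms(1) by (fastforce simp: simplex_faces_def)
  obtain K where K: "1 \<le> K" "\<And>c P Z. 0 \<le> c \<Longrightarrow>
      Poly_Mapping.keys Z \<subseteq> cliques {..M} (\<lambda>u v. cmod (sq_edge_length n P u v) \<le> c) n \<Longrightarrow>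
      aug_boundary Z = 0 \<Longrightarrow>
      \<exists>Y. Poly_Mapping.keys Y \<subseteq> cliques {..M} (\<lambda>u v. cmod (sq_edge_length n P u v) \<le> K * c) (Suc n) \<and>
          aug_boundary Y = Z"
    using bounded_filling[OF assms(1), of M] by blast
  define F where "F = {xs :: nat list. set xs \<subseteq> {..M} \<and> length xs = Suc n}"
  have finF: "finite F" unfolding F_def by (rule finite_lists_length_eq) simp
  define fill where "fill S = (SOME Y. Poly_Mapping.keys Y \<subseteq> S \<and> aug_boundary Y = Z)" for S
  define mass where "mass S = (\<Sum>xs\<in>Poly_Mapping.keys (fill S). real_of_int \<bar>Poly_Mapping.lookup (fill S) xs\<bar>)" for S
  have mass: "0 \<le> mass S" for S unfolding mass_def by (intro sum_nonneg) simp
  define B where "B = sqrt (fact n * (3 / 2 * K) ^ n)"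
  have "cmod (oriented_volume n Z P) \<le> (\<Sum>S\<in>Pow F. mass S) * B * max_sq_edge_length n Z P powr (real n / 2)" for P
  proof -
    define c where "c = max_sq_edge_length n Z P"
    note edges = max_sq_edge_length_bounds[OF keysZ, where n = n and P = P, folded c_def]
    have c: "0 \<le> c" using edges(1) assms(1) by simp
    define S where "S = cliques {..M} (\<lambda>u v. cmod (sq_edge_length n P u v) \<le> K * c) (Suc n)"
    have "Poly_Mapping.keys Z \<subseteq> cliques {..M} (\<lambda>u v. cmod (sq_edge_length n P u v) \<le> c) n"
      using keysZ edges(2) assms(1) by (fastforce simp: cliques_def simplex_faces_def)
    then have "\<exists>Y. Poly_Mapping.keys Y \<subseteq> S \<and> aug_boundary Y = Z"
      using K(2)[OF c _ bd] by (simp add: S_def)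
    then have fill: "Poly_Mapping.keys (fill S) \<subseteq> S" "aug_boundary (fill S) = Z"
      unfolding fill_def by (metis (mono_tags, lifting) someI_ex)+
    have "oriented_volume n Z P = (\<Sum>xs\<in>Poly_Mapping.keys (fill S).
        of_int (Poly_Mapping.lookup (fill S) xs) * oriented_volume n (face_sum xs) P)"
      using oriented_volume_frag_extend[of n face_sum "fill S" P] fill(2) by (simp add: aug_boundary_def)
    also have "cmod \<dots> \<le> (\<Sum>xs\<in>Poly_Mapping.keys (fill S).
        real_of_int \<bar>Poly_Mapping.lookup (fill S) xs\<bar> * (B * c powr (real n / 2)))"
    proof (rule order_trans[OF norm_sum], rule sum_mono)
      fix xs assume "xs \<in> Poly_Mapping.keys (fill S)"
      then have "cmod (oriented_volume n (face_sum xs) P) \<le> B * c powr (real n / 2)"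
        using fill(1) K(1) c assms(1) unfolding B_def S_def by (intro norm_face_volume_le) auto
      then show "cmod (of_int (Poly_Mapping.lookup (fill S) xs) * oriented_volume n (face_sum xs) P)
          \<le> real_of_int \<bar>Poly_Mapping.lookup (fill S) xs\<bar> * (B * c powr (real n / 2))"
        by (simp add: norm_mult mult_left_mono)
    qed
    also have "\<dots> = mass S * (B * c powr (real n / 2))"
      by (simp add: mass_def sum_distrib_right)
    also have "\<dots> \<le> (\<Sum>S\<in>Pow F. mass S) * (B * c powr (real n / 2))"
    proof (rule mult_right_mono)
      have "S \<in> Pow F" by (auto simp: S_def F_def cliques_def)
      then show "mass S \<le> (\<Sum>S\<in>Pow F. mass S)" using finF mass by (intro member_le_sum) auto
      show "0 \<le> B * c powr (real n / 2)" using K(1) by (simp add: B_def)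
    qed
    finally show ?thesis by (simp add: c_def mult.assoc)
  qed
  then show ?thesis by blast
qed

end
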